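(* Let $\mathbb{E}: K\xrightarrow{k}X\xrightarrow{f}M$ be a Schreier extension of monoids with $K$ commutative, let $R_{\mathbb{E}}=\{(x,z)\in X\times X: z=k(a)+x\text{ for some }a\in K\}$, and let $r_1,r_2\colon R_{\mathbb{E}}\to X$ be the two projections $r_1(x,z)=x$, $r_2(x,z)=z$. Then the surjective homomorphism $f$ is a coequaliser of $(r_1,r_2)$ in the category of monoids.
   Context: Monoids $K,X$ are written additively ($X$ is not assumed commutative) and $M$ multiplicatively with unit $1$. A monoid extension $K\xrightarrow{k}X\xrightarrow{f}M$ consists of a surjective monoid homomorphism $f$ and a kernel $(K,k)$ of $f$ (so $k$ is injective with image $\{x: f(x)=1\}$). It is a Schreier extension if for every $m\in M$ there is $u\in f^{-1}(m)$ such that for every $x\in f^{-1}(m)$ there is a unique $a\in K$ with $x=k(a)+u$. $R_{\mathbb{E}}$ is a submonoid of $X\times X$. *)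

theory Defs
  imports "HOL-Algebra.Coset"
begin

text \<open>Elements of \<^const>\<open>hom\<close> need not preserve the unit; morphisms of monoids do.\<close>

definition mon_hom :: "('a, 'p) monoid_scheme \<Rightarrow> ('b, 'q) monoid_scheme \<Rightarrow> ('a \<Rightarrow> 'b) set"
  where "mon_hom G H = {h \<in> hom G H. h \<one>\<^bsub>G\<^esub> = \<one>\<^bsub>H\<^esub>}"

text \<open>All monoids are written multiplicatively, so \<open>k a \<otimes>\<^bsub>X\<^esub> u\<close> stands for \<open>k(a) + u\<close>.
  The pair \<open>(K, k)\<close> is a kernel of \<open>f\<close> up to isomorphism: \<open>k\<close> is an injective homomorphism
  onto the set-theoretic kernel of \<open>f\<close>.\<close>

locale monoid_extension = K: monoid K + X: monoid X + M: monoid M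
  for K :: "('k, 'p) monoid_scheme"
    and X :: "('x, 'q) monoid_scheme"
    and M :: "('m, 'r) monoid_scheme" +
  fixes k :: "'k \<Rightarrow> 'x" and f :: "'x \<Rightarrow> 'm"
  assumes k_hom: "k \<in> mon_hom K X"
    and f_hom: "f \<in> mon_hom X M"
    and f_surj: "f ` carrier X = carrier M"
    and k_inj: "inj_on k (carrier K)"
    and k_image: "k ` carrier K = kernel X M f"

definition fibre :: "('x, 'q) monoid_scheme \<Rightarrow> ('x \<Rightarrow> 'm) \<Rightarrow> 'm \<Rightarrow> 'x set"
  where "fibre X f m = {x \<in> carrier X. f x = m}"

locale schreier_extension = monoid_extension +
  assumes schreier: "\<forall>m \<in> carrier M. \<exists>u \<in> fibre X f m. \<forall>x \<in> fibre X f m.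
      \<exists>!a. a \<in> carrier K \<and> x = k a \<otimes>\<^bsub>X\<^esub> u"

definition schreier_rel ::
    "('k, 'p) monoid_scheme \<Rightarrow> ('x, 'q) monoid_scheme \<Rightarrow> ('k \<Rightarrow> 'x) \<Rightarrow> ('x \<times> 'x) monoid"
  where "schreier_rel K X k = (X \<times>\<times> X)
    \<lparr>carrier := {(x, z). x \<in> carrier X \<and> z \<in> carrier X \<and> (\<exists>a \<in> carrier K. z = k a \<otimes>\<^bsub>X\<^esub> x)}\<rparr>"

text \<open>\<open>q\<close> is a coequaliser of \<open>r\<^sub>1, r\<^sub>2 : R \<rightarrow> X\<close> in the category of monoids, tested against all
  monoids \<open>Y\<close> with elements in the type \<open>'y\<close>. Since HOL has no quantification over types inside a
  formula, \<open>'y\<close> is a parameter, and being a coequaliser means that this holds for every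
  \<open>'y\<close>. A morphism \<open>M \<rightarrow> Y\<close> is determined by its values on \<open>carrier M\<close>, hence the restriction
  to \<^const>\<open>extensional\<close> functions in the uniqueness statement.\<close>

definition mon_coequaliser ::
    "'y itself \<Rightarrow> ('c, 's) monoid_scheme \<Rightarrow> ('x, 'q) monoid_scheme \<Rightarrow> ('m, 'r) monoid_scheme
      \<Rightarrow> ('c \<Rightarrow> 'x) \<Rightarrow> ('c \<Rightarrow> 'x) \<Rightarrow> ('x \<Rightarrow> 'm) \<Rightarrow> bool"
  where "mon_coequaliser (_ :: 'y itself) R X M r\<^sub>1 r\<^sub>2 q \<longleftrightarrow>
    monoid R \<and> monoid X \<and> monoid M \<and>
    r\<^sub>1 \<in> mon_hom R X \<and> r\<^sub>2 \<in> mon_hom R X \<and> q \<in> mon_hom X M \<and>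
    (\<forall>p \<in> carrier R. q (r\<^sub>1 p) = q (r\<^sub>2 p)) \<and>
    (\<forall>(Y :: 'y monoid) g. monoid Y \<and> g \<in> mon_hom X Y \<and>
        (\<forall>p \<in> carrier R. g (r\<^sub>1 p) = g (r\<^sub>2 p)) \<longrightarrow>
      (\<exists>!h. h \<in> mon_hom M Y \<and> h \<in> extensional (carrier M) \<and>
        (\<forall>x \<in> carrier X. h (q x) = g x)))"

end

theory Submission
  imports Defs
begin

text \<open>In each fibre of \<open>f\<close> there is a representative \<open>u\<close> with \<open>(u, x) \<in> R\<close> for all \<open>x\<close> in the
  fibre. Hence a homomorphism that coequalises the projections is constant on the fibres of \<open>f\<close>,
  and so factors through the surjection \<open>f\<close>. Commutativity of \<open>K\<close> enters only in showing that \<open>R\<close>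
  is closed under products: writing \<open>x = k(c) + u\<close> and \<open>u + k(a) = k(d) + u\<close> gives
  \<open>x + k(a) = k(c) + k(d) + u = k(d) + x\<close>.\<close>

context monoid_extension
begin

lemma k_closed [simp]: "a \<in> carrier K \<Longrightarrow> k a \<in> carrier X"
  using k_hom by (auto simp: mon_hom_def hom_def)

lemma f_closed [simp]: "x \<in> carrier X \<Longrightarrow> f x \<in> carrier M"
  using f_hom by (auto simp: mon_hom_def hom_def)

lemma k_mult: "a \<in> carrier K \<Longrightarrow> b \<in> carrier K \<Longrightarrow> k (a \<otimes>\<^bsub>K\<^esub> b) = k a \<otimes>\<^bsub>X\<^esub> k b"
  using k_hom by (auto simp: mon_hom_def hom_def)

lemma k_one: "k \<one>\<^bsub>K\<^esub> = \<one>\<^bsub>X\<^esub>"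
  using k_hom by (simp add: mon_hom_def)

lemma f_mult: "x \<in> carrier X \<Longrightarrow> y \<in> carrier X \<Longrightarrow> f (x \<otimes>\<^bsub>X\<^esub> y) = f x \<otimes>\<^bsub>M\<^esub> f y"
  using f_hom by (auto simp: mon_hom_def hom_def)

lemma f_one: "f \<one>\<^bsub>X\<^esub> = \<one>\<^bsub>M\<^esub>"
  using f_hom by (simp add: mon_hom_def)

lemma f_k: "a \<in> carrier K \<Longrightarrow> f (k a) = \<one>\<^bsub>M\<^esub>"
  using k_image by (auto simp: kernel_def)

lemma f_k_mult: "a \<in> carrier K \<Longrightarrow> x \<in> carrier X \<Longrightarrow> f (k a \<otimes>\<^bsub>X\<^esub> x) = f x"
  by (simp add: f_mult f_k)

end

lemma carrier_schreier_rel: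
  "p \<in> carrier (schreier_rel K X k) \<longleftrightarrow> fst p \<in> carrier X \<and> snd p \<in> carrier X \<and>
    (\<exists>a \<in> carrier K. snd p = k a \<otimes>\<^bsub>X\<^esub> fst p)"
  by (auto simp: schreier_rel_def)

lemma mult_schreier_rel:
  "p \<otimes>\<^bsub>schreier_rel K X k\<^esub> q = (fst p \<otimes>\<^bsub>X\<^esub> fst q, snd p \<otimes>\<^bsub>X\<^esub> snd q)"
  by (simp add: schreier_rel_def DirProd_def case_prod_beta)

lemma one_schreier_rel: "\<one>\<^bsub>schreier_rel K X k\<^esub> = (\<one>\<^bsub>X\<^esub>, \<one>\<^bsub>X\<^esub>)"
  by (simp add: schreier_rel_def DirProd_def)

context schreier_extension
begin

text \<open>Elimination form of the Schreier condition, applied below to the fibre through a given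
  \<open>x\<close>.\<close>

lemma schreier_generator:
  assumes "m \<in> carrier M"
  obtains u where "u \<in> carrier X" "f u = m"
    "\<And>x. x \<in> carrier X \<Longrightarrow> f x = m \<Longrightarrow> \<exists>a \<in> carrier K. x = k a \<otimes>\<^bsub>X\<^esub> u"
proof -
  obtain u where "u \<in> fibre X f m"
    and "\<forall>x \<in> fibre X f m. \<exists>!a. a \<in> carrier K \<and> x = k a \<otimes>\<^bsub>X\<^esub> u"
    using schreier assms by blast
  then show thesis
    by (intro that[of u]) (auto simp: fibre_def)
qed

text \<open>Replaces normality of the kernel in a group extension: with no inverse of
  \<open>x\<close> to conjugate by, \<open>d\<close> is found at the generator \<open>u\<close> of
  the fibre of \<open>x\<close> and then carried over to \<open>x\<close>.\<close>

lemma move_kernel_left: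
  assumes "comm_monoid K" "x \<in> carrier X" "a \<in> carrier K"
  obtains d where "d \<in> carrier K" "x \<otimes>\<^bsub>X\<^esub> k a = k d \<otimes>\<^bsub>X\<^esub> x"
proof -
  obtain u where u: "u \<in> carrier X" "f u = f x"
    and rep: "\<And>y. y \<in> carrier X \<Longrightarrow> f y = f x \<Longrightarrow> \<exists>a \<in> carrier K. y = k a \<otimes>\<^bsub>X\<^esub> u"
    using schreier_generator[OF f_closed[OF assms(2)]] by blast
  obtain c where c: "c \<in> carrier K" "x = k c \<otimes>\<^bsub>X\<^esub> u"
    using rep[of x] assms(2) by auto
  \<comment> \<open>Since \<open>f\<close> sends \<open>k a\<close> to the unit, right translation
    by \<open>k a\<close> stays in the fibre generated by \<open>u\<close>.\<close>
  have "f (u \<otimes>\<^bsub>X\<^esub> k a) = f x"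
    using u assms by (simp add: f_mult f_k)
  then obtain d where d: "d \<in> carrier K" "u \<otimes>\<^bsub>X\<^esub> k a = k d \<otimes>\<^bsub>X\<^esub> u"
    using rep[of "u \<otimes>\<^bsub>X\<^esub> k a"] u assms by auto
  have "k c \<otimes>\<^bsub>X\<^esub> k d = k d \<otimes>\<^bsub>X\<^esub> k c"
    using comm_monoid.m_comm[OF assms(1) c(1) d(1)] c d by (simp flip: k_mult)
  moreover have "x \<otimes>\<^bsub>X\<^esub> k a = (k c \<otimes>\<^bsub>X\<^esub> k d) \<otimes>\<^bsub>X\<^esub> u"
    using c d u assms(3) by (simp add: X.m_assoc)
  ultimately have "x \<otimes>\<^bsub>X\<^esub> k a = k d \<otimes>\<^bsub>X\<^esub> x"
    using c d u by (simp add: X.m_assoc)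
  with d(1) show thesis by (rule that)
qed

lemma schreier_rel_mult_closed:
  assumes "comm_monoid K"
    and p: "p \<in> carrier (schreier_rel K X k)" and q: "q \<in> carrier (schreier_rel K X k)"
  shows "p \<otimes>\<^bsub>schreier_rel K X k\<^esub> q \<in> carrier (schreier_rel K X k)"
proof -
  obtain a where a: "a \<in> carrier K" "snd p = k a \<otimes>\<^bsub>X\<^esub> fst p" and px: "fst p \<in> carrier X"
    using p by (auto simp: carrier_schreier_rel)
  obtain b where b: "b \<in> carrier K" "snd q = k b \<otimes>\<^bsub>X\<^esub> fst q" and qx: "fst q \<in> carrier X"
    using q by (auto simp: carrier_schreier_rel)
  obtain d where d: "d \<in> carrier K" "fst p \<otimes>\<^bsub>X\<^esub> k b = k d \<otimes>\<^bsub>X\<^esub> fst p"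
    using move_kernel_left[OF assms(1) px b(1)] .
  \<comment> \<open>Reassociating isolates the inner factor \<open>fst p\<close> times
    \<open>k b\<close>, where \<open>k b\<close> can be moved to the left; the witness for the
    product pair is then the product of \<open>a\<close> and \<open>d\<close>.\<close>
  have "snd p \<otimes>\<^bsub>X\<^esub> snd q = k a \<otimes>\<^bsub>X\<^esub> (fst p \<otimes>\<^bsub>X\<^esub> k b) \<otimes>\<^bsub>X\<^esub> fst q"
    using a b px qx by (simp add: X.m_assoc)
  also have "\<dots> = k (a \<otimes>\<^bsub>K\<^esub> d) \<otimes>\<^bsub>X\<^esub> (fst p \<otimes>\<^bsub>X\<^esub> fst q)"
    using a d px qx by (simp add: X.m_assoc k_mult)
  finally show ?thesis
    using a d px qx by (auto simp: carrier_schreier_rel mult_schreier_rel)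
qed

lemma monoid_schreier_rel:
  assumes "comm_monoid K"
  shows "monoid (schreier_rel K X k)"
proof (rule monoidI)
  show "\<one>\<^bsub>schreier_rel K X k\<^esub> \<in> carrier (schreier_rel K X k)"
    \<comment> \<open>The unit of \<open>K\<close> relates every element to itself, in particular
      the unit of \<open>X\<close>.\<close>
    using k_one by (auto simp: carrier_schreier_rel one_schreier_rel intro!: bexI[of _ "\<one>\<^bsub>K\<^esub>"])
qed (use schreier_rel_mult_closed[OF assms] in
    \<open>auto simp: carrier_schreier_rel mult_schreier_rel one_schreier_rel X.m_assoc\<close>)

text \<open>As \<open>K\<close> may lack inverses, \<open>x\<close> and \<open>y\<close> need not be
  related in either direction. The generator \<open>u\<close> of their common fibre is related to
  both, which links them by a zigzag.\<close>

lemma constant_on_fibres: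
  assumes g: "\<forall>p \<in> carrier (schreier_rel K X k). g (fst p) = g (snd p)"
    and "x \<in> carrier X" "y \<in> carrier X" "f x = f y"
  shows "g x = g y"
proof -
  obtain u where u: "u \<in> carrier X"
    and rep: "\<And>z. z \<in> carrier X \<Longrightarrow> f z = f x \<Longrightarrow> \<exists>a \<in> carrier K. z = k a \<otimes>\<^bsub>X\<^esub> u"
    using schreier_generator[OF f_closed[OF assms(2)]] by blast
  have "g z = g u" if "z \<in> carrier X" "f z = f x" for z
    \<comment> \<open>The generator has to be the first component, because it is \<open>z\<close>
      that is a translate of \<open>u\<close>.\<close>
    using bspec[OF g, of "(u, z)"] rep[OF that] u that by (simp add: carrier_schreier_rel)
  from this[of x] this[of y] show ?thesis
    using assms by simp
qed

end

text \<open>A surjective homomorphism is the quotient map by the congruence of having equal images,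
  so the factorisation is read off from preimages.\<close>

lemma mon_hom_factor_ex1:
  assumes f: "f \<in> mon_hom X M" and surj: "f ` carrier X = carrier M"
    and "monoid X" and g: "g \<in> mon_hom X Y"
    and const: "\<And>x y. x \<in> carrier X \<Longrightarrow> y \<in> carrier X \<Longrightarrow> f x = f y \<Longrightarrow> g x = g y"
  shows "\<exists>!h. h \<in> mon_hom M Y \<and> h \<in> extensional (carrier M) \<and> (\<forall>x \<in> carrier X. h (f x) = g x)"
proof (rule ex_ex1I)
  interpret X: monoid X by fact
  \<comment> \<open>\<open>h\<close> applies \<open>g\<close> to a chosen preimage; by
    \<open>const\<close> the choice is immaterial. The restriction makes \<open>h\<close>
    extensional.\<close>
  define h where "h = restrict (\<lambda>m. g (inv_into (carrier X) f m)) (carrier M)"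
  have h: "h (f x) = g x" if "x \<in> carrier X" for x
  proof -
    have "f x \<in> f ` carrier X" using that by blast
    then have "g (inv_into (carrier X) f (f x)) = g x"
      by (intro const that) (auto intro: inv_into_into f_inv_into_f)
    then show ?thesis using that surj by (auto simp: h_def)
  qed
  have "h \<in> hom M Y"
  proof (rule homI)
    fix m assume "m \<in> carrier M"
    then show "h m \<in> carrier Y"
      using h g by (auto simp: mon_hom_def hom_def simp flip: surj)
  next
    fix m n assume "m \<in> carrier M" "n \<in> carrier M"
    then obtain x y where xy: "x \<in> carrier X" "m = f x" "y \<in> carrier X" "n = f y"
      using surj by blast
    \<comment> \<open>The product in \<open>M\<close> is lifted to \<open>X\<close>, where
      \<open>h\<close> after \<open>f\<close> computes as the homomorphism \<open>g\<close>.\<close>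
    have "f x \<otimes>\<^bsub>M\<^esub> f y = f (x \<otimes>\<^bsub>X\<^esub> y)"
      using xy f by (simp add: mon_hom_def hom_def)
    then show "h (m \<otimes>\<^bsub>M\<^esub> n) = h m \<otimes>\<^bsub>Y\<^esub> h n"
      using xy h g by (simp add: mon_hom_def hom_def)
  qed
  moreover have "h \<one>\<^bsub>M\<^esub> = \<one>\<^bsub>Y\<^esub>"
    using h[of "\<one>\<^bsub>X\<^esub>"] f g by (simp add: mon_hom_def)
  ultimately show "\<exists>h. h \<in> mon_hom M Y \<and> h \<in> extensional (carrier M) \<and>
      (\<forall>x \<in> carrier X. h (f x) = g x)"
    using h by (intro exI[of _ h]) (auto simp: mon_hom_def h_def)
next
  fix h h'
  assume "h \<in> mon_hom M Y \<and> h \<in> extensional (carrier M) \<and> (\<forall>x \<in> carrier X. h (f x) = g x)"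
    and "h' \<in> mon_hom M Y \<and> h' \<in> extensional (carrier M) \<and> (\<forall>x \<in> carrier X. h' (f x) = g x)"
  then show "h = h'"
    \<comment> \<open>Rewriting \<open>carrier M\<close> as the image of \<open>f\<close> reduces
      equality to points \<open>f x\<close>, where both maps take the value
      \<open>g x\<close>.\<close>
    by (intro extensionalityI[of h "carrier M"]) (auto simp flip: surj)
qed

theorem proposition5p1:
  fixes K :: "('k, 'p) monoid_scheme"
    and X :: "('x, 'q) monoid_scheme"
    and M :: "('m, 'r) monoid_scheme"
    and k :: "'k \<Rightarrow> 'x" and f :: "'x \<Rightarrow> 'm"
  assumes "schreier_extension K X M k f"
    and "comm_monoid K"
  shows "mon_coequaliser TYPE('y) (schreier_rel K X k) X M fst snd f"
proof -
  interpret schreier_extension K X M k f by fact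
  have "fst \<in> mon_hom (schreier_rel K X k) X" "snd \<in> mon_hom (schreier_rel K X k) X"
    by (auto simp: mon_hom_def hom_def carrier_schreier_rel mult_schreier_rel one_schreier_rel)
  moreover have "f (fst p) = f (snd p)" if "p \<in> carrier (schreier_rel K X k)" for p
    using that by (auto simp: carrier_schreier_rel f_k_mult)
  \<comment> \<open>Coequalising the projections makes \<open>g\<close> constant on the fibres of
    \<open>f\<close>, which is the compatibility required by
    \<open>mon_hom_factor_ex1\<close>.\<close>
  moreover have "\<exists>!h. h \<in> mon_hom M Y \<and> h \<in> extensional (carrier M) \<and>
      (\<forall>x \<in> carrier X. h (f x) = g x)"
    if "g \<in> mon_hom X Y" "\<forall>p \<in> carrier (schreier_rel K X k). g (fst p) = g (snd p)"
    for Y :: "'y monoid" and g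
    using that constant_on_fibres[OF that(2)]
    by (intro mon_hom_factor_ex1[OF f_hom f_surj X.monoid_axioms])
  ultimately show ?thesis
    unfolding mon_coequaliser_def
    using monoid_schreier_rel[OF assms(2)] X.monoid_axioms M.monoid_axioms f_hom by blast
qed

end
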